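(* Let $d>1$ be an integer, $\mathbb{O}_d=(\mathbb{R}_+)^d$, $F,G:\mathbb{O}_d\times\mathbb{R}^d\to\mathbb{R}^d$, $r>0$, $\lambda>0$, $T\in\mathcal{L}(\mathbb{R}^d)$, and let $k_{ij}\in[0,+\infty]$ for $i,j\in\{1,\dots,d\}$. Assume: (i) for every $x\in\mathbb{O}_d$, $p\in\mathbb{R}^d$ and $i\in\{1,\dots,d\}$, $x^i=0$ implies $F^i(x,p)\le 0$; moreover $T(\mathbb{O}_d)\subset\mathbb{O}_d$; (ii) there exists $R_*>0$ such that $\sum_{i=1}^d F^i(x,p)\ge 0$ for all $x\in\mathbb{O}_d$ with $|x|_1\ge R_*$ and all $p\in\mathbb{R}^d$; moreover $T(B^1_{R_*})\subset B^1_{R_*}$; (iii) $(G,F)$ is monotone, i.e. $\langle G(x,p)-G(y,q),x-y\rangle+\langle F(x,p)-F(y,q),p-q\rangle\ge 0$ for all $x,y\in\mathbb{O}_d$, $p,q\in\mathbb{R}^d$; (iv) for all $i\in\{1,\dots,d\}$ there exists no non-constant sequence $i=i_0,i_1,\dots,i_{n+1}=i$ in $\{1,\dots,d\}$ such that $k_{i_li_{l+1}}<+\infty$ for all $l\in\{0,\dots,n\}$; moreover $k_{ij}>0$ for all $i,j\in\{1,\dots,d\}$. Then there exists at most one monotone solution $U:\mathbb{O}_d\to\mathbb{R}^d$ of the (stationary) master equation for the mean field game of impulse control. If it exists, this solution is monotone, i.e. $\langle U(x)-U(y),x-y\rangle\ge0$ for all $x,y\in\mathbb{O}_d$.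
   Context: Notation: $|x|_1=x_1+\dots+x_d$ for $x\in\mathbb{O}_d$; $B^1_R=\{x\in\mathbb{O}_d:\ x_1+\dots+x_d\le R\}$; $T^*$ is the adjoint of $T$; $\langle\cdot,\cdot\rangle$ is the Euclidean scalar product. Vector inequalities are componentwise. Jump operator: for $p\in\mathbb{R}^d$ and $i\in\{1,\dots,d\}$, $(Mp)^i=\min\{k_{ij}+p^j:\ j\in\{1,\dots,d\}\}$. Here $k_{ij}$ is the cost of jumping instantly from state $i$ to state $j$; $k_{ij}=+\infty$ means the jump is not allowed. Definition (monotone solution for impulse control). $U\in\mathcal{C}(\mathbb{O}_d,\mathbb{R}^d)$ is a monotone solution of the master equation for the mean field game of impulse control if (1) $U(x)\le MU(x)$ for all $x\in\mathbb{O}_d$; (2) for any $V\in\mathbb{R}^d$ with $V\le MV$, any $y\in\mathbb{O}_d$, any sufficiently large $R>0$ (i.e. any $R\ge R_0$ for some $R_0>0$ independent of $V,y$), and any point $x_0\in B_R^1$ of strict minimum on $B^1_R$ of $x\mapsto\langle U(x)-V,x-y\rangle$ (the minimum over $B^1_R$ is attained at $x_0$ and only there), $$r\langle U(x_0),x_0-y\rangle+\lambda\langle U(x_0)-T^*U(Tx_0),x_0-y\rangle\ \ge\ \langle G(x_0,U(x_0)),x_0-y\rangle+\langle F(x_0,U(x_0)),U(x_0)-V\rangle .$$ *)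

theory Defs
  imports "HOL-Analysis.Analysis"
begin

definition orthant :: "(real^'n) set" where
  "orthant = {x. \<forall>i. 0 \<le> x $ i}"

definition B1 :: "real \<Rightarrow> (real^'n) set" where
  "B1 R = {x \<in> orthant. (\<Sum>i\<in>UNIV. x $ i) \<le> R}"

text \<open>Jump costs lie in \<open>[0, \<infinity>]\<close>. Since \<open>k i i\<close> may be infinite as well, a component of
  the minimum can be \<open>\<infinity>\<close>, so the result is a vector of extended reals.\<close>

definition jump_op :: "('n::finite \<Rightarrow> 'n \<Rightarrow> ereal) \<Rightarrow> real^'n \<Rightarrow> ereal^'n" where
  "jump_op k p = (\<chi> i. Min (range (\<lambda>j. k i j + ereal (p $ j))))"

definition below_jump :: "('n::finite \<Rightarrow> 'n \<Rightarrow> ereal) \<Rightarrow> real^'n \<Rightarrow> bool" where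
  "below_jump k p \<longleftrightarrow> (\<forall>i. ereal (p $ i) \<le> jump_op k p $ i)"

definition strict_min_on :: "'a set \<Rightarrow> ('a \<Rightarrow> real) \<Rightarrow> 'a \<Rightarrow> bool" where
  "strict_min_on S f x0 \<longleftrightarrow> x0 \<in> S \<and> (\<forall>x\<in>S. x \<noteq> x0 \<longrightarrow> f x0 < f x)"

text \<open>Functions on the orthant are total functions whose values outside the orthant are
  irrelevant. The threshold \<open>R0\<close> is uniform in \<open>V\<close> and \<open>y\<close> but may depend on \<open>U\<close>.\<close>

definition impulse_monotone_solution ::
  "(real^'n \<Rightarrow> real^'n \<Rightarrow> real^'n) \<Rightarrow> (real^'n \<Rightarrow> real^'n \<Rightarrow> real^'n) \<Rightarrow> real \<Rightarrow> real \<Rightarrow>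
   (real^'n \<Rightarrow> real^'n) \<Rightarrow> ('n::finite \<Rightarrow> 'n \<Rightarrow> ereal) \<Rightarrow> (real^'n \<Rightarrow> real^'n) \<Rightarrow> bool" where
  "impulse_monotone_solution F G r lam T k U \<longleftrightarrow>
     continuous_on orthant U \<and>
     (\<forall>x\<in>orthant. below_jump k (U x)) \<and>
     (\<exists>R0>0. \<forall>V. \<forall>y\<in>orthant. \<forall>R\<ge>R0. \<forall>x0.
        below_jump k V \<longrightarrow>
        strict_min_on (B1 R) (\<lambda>x. (U x - V) \<bullet> (x - y)) x0 \<longrightarrow>
        r * (U x0 \<bullet> (x0 - y)) + lam * ((U x0 - adjoint T (U (T x0))) \<bullet> (x0 - y))
          \<ge> G x0 (U x0) \<bullet> (x0 - y) + F x0 (U x0) \<bullet> (U x0 - V))"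

end

theory Submission
  imports Defs
begin

text \<open>For two solutions \<open>U\<close>, \<open>V\<close> put \<open>W(x,y) = \<langle>U(x) - V(y), x - y\<rangle>\<close>. If \<open>W\<close>, perturbed by small
  linear terms \<open>\<langle>a,x\<rangle> + \<langle>b,y\<rangle>\<close>, has a strict minimum over \<open>B1 R \<times> B1 R\<close> at \<open>(x0,y0)\<close>, then
  \<open>V(y0) - a\<close> and \<open>U(x0) - b\<close> are the test vectors in the two definitions, and adding both
  inequalities bounds \<open>W\<close> from below. The test vectors must stay below the jump operator, which
  holds if \<open>a\<close> and \<open>b\<close> do not increase along admissible jumps. As the jump graph has no cycles,
  such vectors form a cone with nonempty interior; \<open>a\<close> and \<open>b\<close> are found there by subtracting a
  small multiple of the squared norm before minimising. Although \<open>F\<close> is not assumed continuous, a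
  monotone \<open>(G,F)\<close> has a locally bounded \<open>F\<close>-component up to the boundary of the orthant. Hence
  \<open>W \<ge> 0\<close>, which yields monotonicity (\<open>U = V\<close>) and uniqueness (letting \<open>y\<close> tend to \<open>x\<close>).\<close>

section \<open>Strict minima from a quadratic penalty\<close>

text \<open>Completing the square: replacing \<open>- e * (x \<bullet> x)\<close> by its linear part
  at \<open>x0\<close> leaves a surplus of at least
  \<open>e * ((x - x0) \<bullet> (x - x0))\<close>, which makes the minimum strict.\<close>

lemma strict_min_on_quadratic_penalty:
  fixes f :: "'a::real_inner \<Rightarrow> real"
  assumes "e > 0" "x0 \<in> S" and min: "\<And>x. x \<in> S \<Longrightarrow> f x0 - e * (x0 \<bullet> x0) \<le> f x - e * (x \<bullet> x)"
  shows "strict_min_on S (\<lambda>x. f x - 2 * e * (x0 \<bullet> x)) x0"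
  unfolding strict_min_on_def
proof (intro conjI ballI impI)
  fix x assume x: "x \<in> S" "x \<noteq> x0"
  have "0 < e * ((x - x0) \<bullet> (x - x0))"
    using assms(1) x(2) by simp
  then show "f x0 - 2 * e * (x0 \<bullet> x0) < f x - 2 * e * (x0 \<bullet> x)"
    using min[OF x(1)] by (simp add: inner_diff inner_commute algebra_simps)
qed fact

lemma strict_min_on_shift:
  assumes "strict_min_on S f x0" "\<And>x. g x = f x - c"
  shows "strict_min_on S g x0"
  using assms by (simp add: strict_min_on_def)

section \<open>The jump graph and the jump operator\<close>

text \<open>The rank counts reachable vertices. Along an edge from \<open>i\<close> to
  \<open>j\<close> the reachable set shrinks strictly, since \<open>j\<close> is reachable from
  \<open>i\<close> but, without cycles, not from itself.\<close>

lemma acyclic_rank: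
  fixes E :: "('a::finite \<times> 'a) set"
  assumes "acyclic E"
  obtains h :: "'a \<Rightarrow> nat" where "\<And>i j. (i, j) \<in> E \<Longrightarrow> h j < h i"
proof
  fix i j assume ij: "(i, j) \<in> E"
  have "{m. (j, m) \<in> E\<^sup>+} \<subset> {m. (i, m) \<in> E\<^sup>+}"
    using ij assms by (auto simp: acyclic_def intro: trancl_into_trancl2)
  then show "card {m. (j, m) \<in> E\<^sup>+} < card {m. (i, m) \<in> E\<^sup>+}"
    by (intro psubset_card_mono) auto
qed

lemma acyclic_jump_graph:
  fixes k :: "'n \<Rightarrow> 'n \<Rightarrow> ereal"
  assumes "\<forall>i. \<not> (\<exists>(n::nat) (s :: nat \<Rightarrow> 'n). s 0 = i \<and> s (n + 1) = i \<and>
           (\<exists>l\<le>n + 1. s l \<noteq> i) \<and> (\<forall>l\<le>n. k (s l) (s (l + 1)) < \<infinity>))"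
  shows "acyclic {(i, j). i \<noteq> j \<and> k i j < \<infinity>}" (is "acyclic ?E")
  unfolding acyclic_def
proof (intro allI notI)
  fix i assume "(i, i) \<in> ?E\<^sup>+"
  then obtain n where n: "n > 0" "(i, i) \<in> ?E ^^ n"
    by (auto simp: trancl_power)
  then obtain m where m: "n = Suc m"
    by (cases n) auto
  from n(2) obtain s where s: "s 0 = i" "s n = i" "\<And>l. l < n \<Longrightarrow> (s l, s (Suc l)) \<in> ?E"
    by (auto simp: relpow_fun_conv)
  \<comment> \<open>The graph omits loops, so the first edge already makes the closed walk
    non-constant.\<close>
  have "s 1 \<noteq> i"
    using s(1) s(3)[of 0] n(1) by auto
  moreover have "\<forall>l\<le>m. k (s l) (s (l + 1)) < \<infinity>"
    using s(3) m by (auto simp: less_Suc_eq_le)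
  ultimately have "s 0 = i \<and> s (m + 1) = i \<and> (\<exists>l\<le>m + 1. s l \<noteq> i) \<and> (\<forall>l\<le>m. k (s l) (s (l + 1)) < \<infinity>)"
    using s(1,2) m by (intro conjI exI[of _ 1]) auto
  with assms show False by blast
qed

lemma below_jump_iff: "below_jump k p \<longleftrightarrow> (\<forall>i j. ereal (p $ i) \<le> k i j + ereal (p $ j))"
  by (auto simp: below_jump_def jump_op_def Min_ge_iff)

text \<open>Subtracting \<open>a\<close> lowers the left side at least as much as the right side
  along every admissible jump; a jump of infinite cost imposes nothing.\<close>

lemma below_jump_diff:
  assumes p: "below_jump k p" and a: "\<And>i j. i \<noteq> j \<Longrightarrow> k i j < \<infinity> \<Longrightarrow> a $ j \<le> a $ i"
  shows "below_jump k (p - a)"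
  unfolding below_jump_iff
proof (intro allI)
  fix i j
  have le: "ereal (p $ i) \<le> k i j + ereal (p $ j)"
    using p by (simp add: below_jump_iff)
  have "a $ j \<le> a $ i" if "k i j < \<infinity>"
    using a[OF _ that] by (cases "i = j") auto
  then show "ereal ((p - a) $ i) \<le> k i j + ereal ((p - a) $ j)"
    using le by (cases "k i j") auto
qed

section \<open>The simplex \<open>B1 R\<close>\<close>

lemma B1_component_le:
  assumes "x \<in> B1 R"
  shows "x $ i \<le> R"
proof -
  have "x $ i \<le> (\<Sum>i\<in>UNIV. x $ i)"
    using assms by (intro member_le_sum) (auto simp: B1_def orthant_def)
  with assms show ?thesis by (simp add: B1_def)
qed

lemma B1_norm_le:
  fixes x :: "real^'n"
  assumes "x \<in> B1 R"
  shows "norm x \<le> R"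
proof -
  have "norm x \<le> (\<Sum>i\<in>UNIV. \<bar>x $ i\<bar>)"
    by (rule norm_le_l1_cart)
  also have "\<dots> = (\<Sum>i\<in>UNIV. x $ i)"
    using assms by (intro sum.cong) (auto simp: B1_def orthant_def)
  finally show ?thesis using assms by (simp add: B1_def)
qed

lemma compact_B1: "compact (B1 R :: (real^'n) set)"
proof -
  have "B1 R = (\<Inter>i. {x :: real^'n. 0 \<le> x $ i}) \<inter> {x. (\<Sum>i\<in>UNIV. x $ i) \<le> R}"
    by (auto simp: B1_def orthant_def)
  moreover have "closed {x :: real^'n. 0 \<le> x $ i}" for i
    by (intro closed_Collect_le continuous_intros)
  moreover have "closed {x :: real^'n. (\<Sum>i\<in>UNIV. x $ i) \<le> R}"
    by (intro closed_Collect_le continuous_intros)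
  ultimately have "closed (B1 R :: (real^'n) set)"
    by (simp add: closed_INT closed_Int)
  moreover have "bounded (B1 R :: (real^'n) set)"
    using B1_norm_le by (auto simp: bounded_iff)
  ultimately show ?thesis by (simp add: compact_eq_bounded_closed)
qed

text \<open>By homogeneity, invariance at one positive radius gives invariance at all of them, so
  \<open>T\<close> preserves the simplex on which solutions are compared.\<close>

lemma linear_image_B1:
  fixes T :: "real^'n \<Rightarrow> real^'n"
  assumes "linear T" "S > 0" "T ` B1 S \<subseteq> B1 S" "R > 0" "x \<in> B1 R"
  shows "T x \<in> B1 R"
proof -
  have "(S / R) *\<^sub>R x \<in> B1 S"
    using assms by (auto simp: B1_def orthant_def field_simps simp flip: sum_distrib_left sum_divide_distrib)
  then have "(S / R) *\<^sub>R T x \<in> B1 S"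
    using assms(1,3) by (auto simp: linear_scale[symmetric])
  then show ?thesis
    using assms(2,4)
    by (auto simp: B1_def orthant_def zero_le_mult_iff zero_le_divide_iff field_simps
        simp flip: sum_distrib_left sum_divide_distrib)
qed

section \<open>Local boundedness of monotone pairs\<close>

text \<open>Comparing \<open>(x,p)\<close> with the vertices of a box bounds \<open>\<langle>(G x p, F x p), v - (x,p)\<rangle>\<close> from above
  for all \<open>v\<close> in the box. A ball in the \<open>p\<close>-directions around \<open>(x,p)\<close> lies in the box even if \<open>x\<close> is
  on the boundary of the orthant.\<close>

lemma monotone_pair_locally_bounded:
  fixes F G :: "real^'n \<Rightarrow> real^'n \<Rightarrow> real^'n"
  assumes mono: "\<And>x y p q. x \<in> orthant \<Longrightarrow> y \<in> orthant \<Longrightarrow>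
      (G x p - G y q) \<bullet> (x - y) + (F x p - F y q) \<bullet> (p - q) \<ge> 0"
  shows "\<exists>K\<ge>0. \<forall>x\<in>B1 R. \<forall>p. norm p \<le> M \<longrightarrow> norm (F x p) \<le> K"
proof -
  define P :: "((real^'n) \<times> (real^'n)) set" where
    "P = cbox 0 (\<chi> i. R) \<times> cbox (\<chi> i. - (M + 1)) (\<chi> i. M + 1)"
  define A where "A v = (G (fst v) (snd v), F (fst v) (snd v))" for v
  have "polytope P"
    unfolding P_def by (intro polytope_Times polytope_interval)
  then obtain S where S: "finite S" "P = convex hull S"
    by (auto simp: polytope_def)
  have "bounded P"
    unfolding P_def by (intro bounded_Times bounded_cbox)
  then obtain D where D: "\<And>v. v \<in> P \<Longrightarrow> norm v \<le> D"
    by (auto simp: bounded_iff)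
  define K where "K = (\<Sum>v\<in>S. norm (A v) * (2 * \<bar>D\<bar>))"
  have SP: "S \<subseteq> P"
    using S(2) hull_subset[of S convex] by simp
  have P_orthant: "fst v \<in> orthant" if "v \<in> P" for v
    using that by (auto simp: P_def orthant_def mem_box_cart)
  have vertex: "A z \<bullet> v - A z \<bullet> z \<le> K" if "z \<in> P" "v \<in> S" for z v
  proof -
    have v: "v \<in> P" using SP that by auto
    have "(A z - A v) \<bullet> (z - v) \<ge> 0"
      using mono[OF P_orthant[OF that(1)] P_orthant[OF v], of "snd z" "snd v"]
      by (simp add: A_def inner_prod_def)
    then have "A z \<bullet> v - A z \<bullet> z \<le> A v \<bullet> (v - z)"
      by (simp add: inner_diff algebra_simps)
    also have "\<dots> \<le> norm (A v) * norm (v - z)"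
      by (rule norm_cauchy_schwarz)
    also have "\<dots> \<le> norm (A v) * (2 * \<bar>D\<bar>)"
      using D[OF v] D[OF that(1)] norm_triangle_ineq4[of v z] by (intro mult_left_mono) auto
    also have "\<dots> \<le> K"
      unfolding K_def using S(1) that(2)
      by (intro member_le_sum[where f = "\<lambda>v. norm (A v) * (2 * \<bar>D\<bar>)"]) auto
    finally show ?thesis .
  qed
  have hull: "A z \<bullet> v - A z \<bullet> z \<le> K" if "z \<in> P" "v \<in> P" for z v
  proof -
    have "convex hull S \<subseteq> {v. A z \<bullet> v \<le> K + A z \<bullet> z}"
      using vertex[OF that(1)] by (intro hull_minimal convex_halfspace_le) (auto simp: algebra_simps)
    then show ?thesis using that S(2) by auto
  qed
  have "norm (F x p) \<le> K" if x: "x \<in> B1 R" and p: "norm p \<le> M" for x p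
  proof -
    have inP: "(x, q) \<in> P" if "norm q \<le> M + 1" for q
    proof -
      have "- (M + 1) \<le> q $ i \<and> q $ i \<le> M + 1" for i
        using component_le_norm_cart[of q i] that by linarith
      then show ?thesis
        using x B1_component_le[OF x]
        by (auto simp: P_def mem_box_cart B1_def orthant_def)
    qed
    \<comment> \<open>The margin 1 in the \<open>p\<close>-box admits this unit step; in the
      direction \<open>sgn (F x p)\<close> the inner product becomes the norm.\<close>
    have "norm (p + sgn (F x p)) \<le> M + 1"
      using norm_triangle_ineq[of p "sgn (F x p)"] p by (auto simp: norm_sgn split: if_splits)
    moreover have "norm p \<le> M + 1" using p by simp
    ultimately have "A (x, p) \<bullet> (x, p + sgn (F x p)) - A (x, p) \<bullet> (x, p) \<le> K"
      by (intro hull inP)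
    then have "F x p \<bullet> sgn (F x p) \<le> K"
      by (simp add: A_def inner_right_distrib)
    moreover have "F x p \<bullet> sgn (F x p) = norm (F x p)"
      by (cases "F x p = 0") (auto simp: sgn_div_norm dot_square_norm power2_eq_square)
    ultimately show ?thesis by simp
  qed
  moreover have "K \<ge> 0"
    unfolding K_def by (intro sum_nonneg) auto
  ultimately show ?thesis by blast
qed

section \<open>Doubling of variables for two solutions\<close>

lemma inner_bounds:
  fixes a x :: "'a::real_inner"
  assumes "norm a \<le> A" "norm x \<le> B"
  shows "\<bar>a \<bullet> x\<bar> \<le> A * B"
proof -
  have "\<bar>a \<bullet> x\<bar> \<le> norm a * norm x"
    by (rule Cauchy_Schwarz_ineq2)
  also have "\<dots> \<le> A * B"
    using assms norm_ge_zero order_trans by (intro mult_mono) blast+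
  finally show ?thesis .
qed

lemma impulse_solutions_cross_monotone:
  fixes F G :: "real^'n \<Rightarrow> real^'n \<Rightarrow> real^'n"
    and T :: "real^'n \<Rightarrow> real^'n"
    and k :: "'n::finite \<Rightarrow> 'n \<Rightarrow> ereal"
  assumes r: "r > 0" and lam: "lam > 0" and T: "linear T"
    and Rs: "Rs > 0" "T ` B1 Rs \<subseteq> B1 Rs"
    and mono: "\<And>x y p q. x \<in> orthant \<Longrightarrow> y \<in> orthant \<Longrightarrow>
      (G x p - G y q) \<bullet> (x - y) + (F x p - F y q) \<bullet> (p - q) \<ge> 0"
    and acyc: "acyclic {(i, j). i \<noteq> j \<and> k i j < \<infinity>}"
    and U: "impulse_monotone_solution F G r lam T k U"
    and V: "impulse_monotone_solution F G r lam T k V"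
    and x: "x \<in> orthant" and y: "y \<in> orthant"
  shows "(U x - V y) \<bullet> (x - y) \<ge> 0"
proof -
  define W where "W x y = (U x - V y) \<bullet> (x - y)" for x y
  have U_cont: "continuous_on orthant U" and V_cont: "continuous_on orthant V"
    using U V by (auto simp: impulse_monotone_solution_def)
  have U_below: "below_jump k (U x)" and V_below: "below_jump k (V x)" if "x \<in> orthant" for x
    using U V that by (auto simp: impulse_monotone_solution_def)
  obtain R1 where U_ineq: "\<And>p y R x0. \<lbrakk>y \<in> orthant; R \<ge> R1; below_jump k p;
        strict_min_on (B1 R) (\<lambda>x. (U x - p) \<bullet> (x - y)) x0\<rbrakk> \<Longrightarrow>
        r * (U x0 \<bullet> (x0 - y)) + lam * ((U x0 - adjoint T (U (T x0))) \<bullet> (x0 - y))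
          \<ge> G x0 (U x0) \<bullet> (x0 - y) + F x0 (U x0) \<bullet> (U x0 - p)"
    using U unfolding impulse_monotone_solution_def by blast
  obtain R2 where V_ineq: "\<And>p y R x0. \<lbrakk>y \<in> orthant; R \<ge> R2; below_jump k p;
        strict_min_on (B1 R) (\<lambda>x. (V x - p) \<bullet> (x - y)) x0\<rbrakk> \<Longrightarrow>
        r * (V x0 \<bullet> (x0 - y)) + lam * ((V x0 - adjoint T (V (T x0))) \<bullet> (x0 - y))
          \<ge> G x0 (V x0) \<bullet> (x0 - y) + F x0 (V x0) \<bullet> (V x0 - p)"
    using V unfolding impulse_monotone_solution_def by blast
  \<comment> \<open>One radius exceeds both thresholds, is positive, and puts the two given points
    into the simplex.\<close>
  define R where "R = Max {R1, R2, 1, \<Sum>i\<in>UNIV. x $ i, \<Sum>i\<in>UNIV. y $ i}"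
  have R: "R \<ge> R1" "R \<ge> R2" "R > 0" and xR: "x \<in> B1 R" and yR: "y \<in> B1 R"
    using x y by (auto simp: R_def B1_def less_max_iff_disj le_max_iff_disj)
  have B1_orthant: "B1 R \<subseteq> (orthant :: (real^'n) set)"
    by (auto simp: B1_def)
  have U_cont': "continuous_on (B1 R) U" and V_cont': "continuous_on (B1 R) V"
    using continuous_on_subset[OF _ B1_orthant] U_cont V_cont by auto
  have "bounded (U ` B1 R \<union> V ` B1 R)"
    using compact_continuous_image[OF U_cont' compact_B1] compact_continuous_image[OF V_cont' compact_B1]
    by (simp add: compact_imp_bounded)
  then obtain M where M: "\<And>x. x \<in> B1 R \<Longrightarrow> norm (U x) \<le> M" "\<And>x. x \<in> B1 R \<Longrightarrow> norm (V x) \<le> M"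
    by (auto simp: bounded_iff)
  obtain K where K: "K \<ge> 0" "\<And>x p. x \<in> B1 R \<Longrightarrow> norm p \<le> M \<Longrightarrow> norm (F x p) \<le> K"
    using monotone_pair_locally_bounded[of G F R M, OF mono] by blast
  obtain h :: "'n \<Rightarrow> nat" where "\<And>i j. (i, j) \<in> {(i, j). i \<noteq> j \<and> k i j < \<infinity>} \<Longrightarrow> h j < h i"
    using acyclic_rank[OF acyc] by blast
  then have h: "h j < h i" if "i \<noteq> j" "k i j < \<infinity>" for i j
    using that by blast
  define rho :: "real^'n" where "rho = (\<chi> i. real (h i))"
  define N where "N = norm rho + 1"
  \<comment> \<open>\<open>rho\<close> drops by at least 1 along each admissible jump, while the
    components of \<open>z / R\<close> lie in [0,1]; hence the difference cannot increase along the
    jump.\<close>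
  have pert_below: "below_jump k (p - eta *\<^sub>R (rho - (1 / R) *\<^sub>R z))"
    if "below_jump k p" "z \<in> B1 R" "eta > 0" for p z eta
  proof (rule below_jump_diff[OF that(1)])
    fix i j assume "i \<noteq> j" "k i j < \<infinity>"
    then have "real (h j) + 1 \<le> real (h i)"
      using h[of i j] by linarith
    moreover have "z $ i / R \<le> 1" "0 \<le> z $ j / R"
      using B1_component_le[OF that(2), of i] that(2) R(3) by (auto simp: B1_def orthant_def)
    ultimately have "real (h j) - z $ j / R \<le> real (h i) - z $ i / R"
      by linarith
    then show "(eta *\<^sub>R (rho - (1 / R) *\<^sub>R z)) $ j \<le> (eta *\<^sub>R (rho - (1 / R) *\<^sub>R z)) $ i"
      using that(3) by (simp add: rho_def)
  qed
  have pert_norm: "norm (rho - (1 / R) *\<^sub>R z) \<le> N" if "z \<in> B1 R" for z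
  proof -
    have "norm ((1 / R) *\<^sub>R z) \<le> 1"
      using B1_norm_le[OF that] R(3) by simp
    then show ?thesis
      unfolding N_def using norm_triangle_ineq4[of rho "(1 / R) *\<^sub>R z"] by linarith
  qed
  have diff_norm: "norm (z - z') \<le> 2 * R" if "z \<in> B1 R" "z' \<in> B1 R" for z z' :: "real^'n"
    using B1_norm_le[OF that(1)] B1_norm_le[OF that(2)] norm_triangle_ineq4[of z z'] by linarith
  have T_B1: "T z \<in> B1 R" if "z \<in> B1 R" for z
    using linear_image_B1[OF T Rs R(3) that] .
  \<comment> \<open>The quotient collects the errors from the \<open>T\<close>-term and from
    \<open>F\<close>; the last summand is the cost of passing from the minimiser to
    \<open>(x, y)\<close>. Nothing here depends on \<open>eta\<close>.\<close>
  define C where "C = (4 * lam * N * R + 2 * N * K) / r + 4 * N * R"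
  have lower: "W x y \<ge> - (eta * C)" if eta: "eta > 0" for eta
  proof -
    \<comment> \<open>With this \<open>e\<close>, the gradients of the perturbation at the minimiser
      are \<open>eta *\<^sub>R a\<close> and \<open>eta *\<^sub>R b\<close> for the \<open>a\<close>
      and \<open>b\<close> below, the form covered by \<open>pert_below\<close>.\<close>
    define e where "e = eta / (2 * R)"
    have e: "e > 0" "2 * e = eta / R"
      using eta R(3) by (auto simp: e_def)
    define Phi where "Phi z = W (fst z) (snd z) + eta * (rho \<bullet> fst z + rho \<bullet> snd z)
        - e * (fst z \<bullet> fst z + snd z \<bullet> snd z)" for z
    have Phi_cont: "continuous_on (B1 R \<times> B1 R) Phi"
      unfolding Phi_def W_def
      by (intro continuous_intros continuous_on_compose2[OF U_cont'] continuous_on_compose2[OF V_cont']) auto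
    have ne: "B1 R \<times> B1 R \<noteq> ({} :: ((real^'n) \<times> (real^'n)) set)"
      using xR by auto
    obtain z0 where z0: "z0 \<in> B1 R \<times> B1 R" "\<And>z. z \<in> B1 R \<times> B1 R \<Longrightarrow> Phi z0 \<le> Phi z"
      using continuous_attains_inf[OF compact_Times[OF compact_B1 compact_B1] ne Phi_cont] by blast
    define x0 y0 where "x0 = fst z0" and "y0 = snd z0"
    have x0: "x0 \<in> B1 R" and y0: "y0 \<in> B1 R"
      using z0(1) by (auto simp: x0_def y0_def)
    have min: "Phi (x0, y0) \<le> Phi (u, v)" if "u \<in> B1 R" "v \<in> B1 R" for u v
      using z0(2)[of "(u, v)"] that by (simp add: x0_def y0_def)
    define a b where "a = rho - (1 / R) *\<^sub>R x0" and "b = rho - (1 / R) *\<^sub>R y0"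
    have aN: "norm a \<le> N" and bN: "norm b \<le> N"
      using pert_norm x0 y0 by (auto simp: a_def b_def)
    have pert_inner: "eta * ((rho - (1 / R) *\<^sub>R z) \<bullet> u) = eta * (rho \<bullet> u) - 2 * e * (z \<bullet> u)" for z u
      using e(2) by (simp add: inner_diff algebra_simps)
    have min_x: "strict_min_on (B1 R) (\<lambda>x. (U x - (V y0 - eta *\<^sub>R a)) \<bullet> (x - y0)) x0"
    proof -
      have "strict_min_on (B1 R) (\<lambda>x. W x y0 + eta * (rho \<bullet> x) - 2 * e * (x0 \<bullet> x)) x0"
        using min[OF _ y0] by (intro strict_min_on_quadratic_penalty e x0) (simp add: Phi_def algebra_simps)
      moreover have "(U x - (V y0 - eta *\<^sub>R a)) \<bullet> (x - y0) =
          W x y0 + eta * (rho \<bullet> x) - 2 * e * (x0 \<bullet> x) - eta * (a \<bullet> y0)" for x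
        using pert_inner[of x0 x] by (simp add: W_def a_def[symmetric] inner_diff inner_add algebra_simps)
      ultimately show ?thesis by (rule strict_min_on_shift)
    qed
    have min_y: "strict_min_on (B1 R) (\<lambda>y. (V y - (U x0 - eta *\<^sub>R b)) \<bullet> (y - x0)) y0"
    proof -
      have "strict_min_on (B1 R) (\<lambda>y. W x0 y + eta * (rho \<bullet> y) - 2 * e * (y0 \<bullet> y)) y0"
        using min[OF x0] by (intro strict_min_on_quadratic_penalty e y0) (simp add: Phi_def algebra_simps)
      moreover have "(V y - (U x0 - eta *\<^sub>R b)) \<bullet> (y - x0) =
          W x0 y + eta * (rho \<bullet> y) - 2 * e * (y0 \<bullet> y) - eta * (b \<bullet> x0)" for y
        using pert_inner[of y0 y] by (simp add: W_def b_def[symmetric] inner_diff inner_add algebra_simps)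
      ultimately show ?thesis by (rule strict_min_on_shift)
    qed
    have min_W: "W x0 y0 \<le> W u v + eta * (a \<bullet> (u - x0) + b \<bullet> (v - y0))
        + e * (2 * (x0 \<bullet> (u - x0)) + x0 \<bullet> x0 - u \<bullet> u + 2 * (y0 \<bullet> (v - y0)) + y0 \<bullet> y0 - v \<bullet> v)"
      if "u \<in> B1 R" "v \<in> B1 R" for u v
      using min[OF that] pert_inner[of x0 "u - x0"] pert_inner[of y0 "v - y0"]
      unfolding Phi_def a_def[symmetric] b_def[symmetric]
      by (simp add: inner_diff_right algebra_simps)
    have W_le: "W x0 y0 \<le> W u v + eta * (4 * N * R)" if "u \<in> B1 R" "v \<in> B1 R" for u v
    proof -
      \<comment> \<open>The penalty is concave, so its second-order remainder has the favourable
        sign and only the linear terms cost anything.\<close>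
      have "2 * (x0 \<bullet> (u - x0)) + x0 \<bullet> x0 - u \<bullet> u + 2 * (y0 \<bullet> (v - y0)) + y0 \<bullet> y0 - v \<bullet> v
          = - ((u - x0) \<bullet> (u - x0) + (v - y0) \<bullet> (v - y0))"
        by (simp add: inner_diff inner_commute algebra_simps)
      also have "\<dots> \<le> 0"
        by (smt (verit) inner_ge_zero)
      finally have "W x0 y0 \<le> W u v + eta * (a \<bullet> (u - x0) + b \<bullet> (v - y0))"
        using min_W[OF that] e(1) by (smt (verit) mult_nonneg_nonpos)
      moreover have "a \<bullet> (u - x0) + b \<bullet> (v - y0) \<le> 4 * N * R"
        using inner_bounds[OF aN diff_norm[OF that(1) x0]] inner_bounds[OF bN diff_norm[OF that(2) y0]]
        by linarith
      then have "eta * (a \<bullet> (u - x0) + b \<bullet> (v - y0)) \<le> eta * (4 * N * R)"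
        using eta by simp
      ultimately show ?thesis by linarith
    qed
    have x0': "x0 \<in> orthant" and y0': "y0 \<in> orthant"
      using x0 y0 B1_orthant by auto
    have ineq_x: "r * (U x0 \<bullet> (x0 - y0)) + lam * ((U x0 - adjoint T (U (T x0))) \<bullet> (x0 - y0))
          \<ge> G x0 (U x0) \<bullet> (x0 - y0) + F x0 (U x0) \<bullet> (U x0 - (V y0 - eta *\<^sub>R a))"
      by (rule U_ineq[OF y0' R(1) _ min_x])
        (unfold a_def, rule pert_below[OF V_below[OF y0'] x0 eta])
    have ineq_y: "r * (V y0 \<bullet> (y0 - x0)) + lam * ((V y0 - adjoint T (V (T y0))) \<bullet> (y0 - x0))
          \<ge> G y0 (V y0) \<bullet> (y0 - x0) + F y0 (V y0) \<bullet> (V y0 - (U x0 - eta *\<^sub>R b))"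
      by (rule V_ineq[OF x0' R(2) _ min_y])
        (unfold b_def, rule pert_below[OF U_below[OF x0'] y0 eta])
    have adj: "adjoint T p \<bullet> z = p \<bullet> T z" for p z
      using adjoint_works[OF T, of z p] by (simp add: inner_commute)
    \<comment> \<open>In the sum of the two inequalities, monotonicity of \<open>(G, F)\<close>
      absorbs all terms but those pairing \<open>F\<close> with \<open>a\<close> and
      \<open>b\<close>; the adjoint terms combine to \<open>W (T x0) (T y0)\<close>.\<close>
    have "r * W x0 y0 + lam * (W x0 y0 - W (T x0) (T y0))
        \<ge> eta * (F x0 (U x0) \<bullet> a + F y0 (V y0) \<bullet> b)"
      using ineq_x ineq_y mono[OF x0' y0', of "U x0" "V y0"]
      by (simp add: W_def inner_diff inner_add adj linear_diff[OF T] algebra_simps)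
    moreover have "lam * (W x0 y0 - W (T x0) (T y0)) \<le> lam * (eta * (4 * N * R))"
      using W_le[OF T_B1[OF x0] T_B1[OF y0]] lam by (intro mult_left_mono) auto
    moreover have "eta * (F x0 (U x0) \<bullet> a + F y0 (V y0) \<bullet> b) \<ge> eta * (- (2 * N * K))"
      using inner_bounds[OF K(2)[OF x0 M(1)[OF x0]] aN] inner_bounds[OF K(2)[OF y0 M(2)[OF y0]] bN] eta
      by (intro mult_left_mono) (auto simp: algebra_simps)
    ultimately have "r * W x0 y0 \<ge> - (eta * (4 * lam * N * R + 2 * N * K))"
      by (simp add: algebra_simps)
    then have "W x0 y0 \<ge> - (eta * ((4 * lam * N * R + 2 * N * K) / r))"
      using r by (simp add: field_simps)
    with W_le[OF xR yR] show ?thesis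
      by (simp add: C_def algebra_simps)
  qed
  have "((\<lambda>eta. - (eta * C)) \<longlongrightarrow> - (0 * C)) (at_right 0)"
    by (intro tendsto_intros)
  moreover have "\<forall>\<^sub>F eta in at_right 0. - (eta * C) \<le> W x y"
    using lower by (intro eventually_at_rightI[of 0 1]) auto
  ultimately have "0 \<le> W x y"
    using tendsto_upperbound[of "\<lambda>eta. - (eta * C)"] by fastforce
  then show ?thesis by (simp add: W_def)
qed

section \<open>Equality from cross monotonicity\<close>

text \<open>Minty's argument at interior points: test with \<open>y = x - t *\<^sub>R h\<close>,
  where \<open>h = V x - U x\<close>, divide by \<open>t\<close> and let \<open>t\<close> tend to 0.
  This gives \<open>- (h \<bullet> h) \<ge> 0\<close>.\<close>

lemma cross_monotone_imp_eq:
  fixes U V :: "real^'n \<Rightarrow> real^'n"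
  assumes U: "continuous_on orthant U" and V: "continuous_on orthant V"
    and W: "\<And>x y. x \<in> orthant \<Longrightarrow> y \<in> orthant \<Longrightarrow> (U x - V y) \<bullet> (x - y) \<ge> 0"
    and x: "x \<in> orthant"
  shows "U x = V x"
proof -
  have interior: "U x = V x" if pos: "\<And>i. x $ i > 0" for x
  proof -
    define h where "h = V x - U x"
    have xo: "x \<in> orthant"
      using pos by (auto simp: orthant_def less_imp_le)
    have "((\<lambda>t. x - t *\<^sub>R h) \<longlongrightarrow> x - 0 *\<^sub>R h) (at_right 0)"
      by (intro tendsto_intros)
    then have lim: "((\<lambda>t. x - t *\<^sub>R h) \<longlongrightarrow> x) (at_right 0)" by simp
    have "\<forall>\<^sub>F t in at_right 0. 0 < (x - t *\<^sub>R h) $ i" for i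
      using order_tendstoD(1)[OF tendsto_vec_nth[OF lim] pos] .
    then have "\<forall>\<^sub>F t in at_right 0. \<forall>i. 0 < (x - t *\<^sub>R h) $ i"
      by (rule eventually_all_finite)
    then have ev: "\<forall>\<^sub>F t in at_right 0. x - t *\<^sub>R h \<in> orthant"
      by eventually_elim (simp add: orthant_def less_imp_le)
    have limV: "((\<lambda>t. V (x - t *\<^sub>R h)) \<longlongrightarrow> V x) (at_right 0)"
      using continuous_on_tendsto_compose[OF V lim xo ev] .
    have "((\<lambda>t. (U x - V (x - t *\<^sub>R h)) \<bullet> h) \<longlongrightarrow> (U x - V x) \<bullet> h) (at_right 0)"
      by (intro tendsto_intros limV)
    moreover have "\<forall>\<^sub>F t in at_right 0. 0 \<le> (U x - V (x - t *\<^sub>R h)) \<bullet> h"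
      using ev eventually_at_right_less[of 0]
    proof eventually_elim
      case (elim t)
      then show ?case using W[OF xo elim(1)] by (simp add: zero_le_mult_iff)
    qed
    ultimately have "0 \<le> (U x - V x) \<bullet> h"
      by (intro tendsto_lowerbound) auto
    moreover have "(U x - V x) \<bullet> h = - (h \<bullet> h)"
      by (simp add: h_def inner_diff algebra_simps)
    ultimately have "h = 0"
      by (metis inner_eq_zero_iff inner_ge_zero neg_0_le_iff_le order_antisym)
    then show ?thesis
      by (simp add: h_def)
  qed
  \<comment> \<open>Here \<open>1\<close> is the all-ones vector, which points into the interior
    from every boundary point; continuity extends the equality.\<close>
  have "((\<lambda>t. x + t *\<^sub>R 1) \<longlongrightarrow> x + 0 *\<^sub>R 1) (at_right 0)"
    by (intro tendsto_intros)
  then have lim: "((\<lambda>t. x + t *\<^sub>R 1) \<longlongrightarrow> x) (at_right 0)" by simp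
  have pos: "\<forall>\<^sub>F t in at_right 0. \<forall>i. 0 < (x + t *\<^sub>R 1) $ i"
    using eventually_at_right_less[of "0::real"]
    by eventually_elim (use x in \<open>auto simp: orthant_def add_nonneg_pos\<close>)
  then have ev: "\<forall>\<^sub>F t in at_right 0. x + t *\<^sub>R 1 \<in> orthant"
    by eventually_elim (auto simp: orthant_def less_imp_le)
  have "((\<lambda>t. U (x + t *\<^sub>R 1)) \<longlongrightarrow> U x) (at_right 0)"
    using continuous_on_tendsto_compose[OF U lim x ev] .
  moreover have "\<forall>\<^sub>F t in at_right 0. U (x + t *\<^sub>R 1) = V (x + t *\<^sub>R 1)"
    using pos by eventually_elim (auto intro: interior)
  ultimately have "((\<lambda>t. V (x + t *\<^sub>R 1)) \<longlongrightarrow> U x) (at_right 0)"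
    by (rule Lim_transform_eventually)
  moreover have "((\<lambda>t. V (x + t *\<^sub>R 1)) \<longlongrightarrow> V x) (at_right 0)"
    using continuous_on_tendsto_compose[OF V lim x ev] .
  ultimately show ?thesis
    by (rule tendsto_unique[OF trivial_limit_at_right_real])
qed

theorem theorem4p1:
  fixes F G :: "real^'n \<Rightarrow> real^'n \<Rightarrow> real^'n"
    and r lam :: real
    and T :: "real^'n \<Rightarrow> real^'n"
    and k :: "'n::finite \<Rightarrow> 'n \<Rightarrow> ereal"
  assumes "CARD('n) > 1"
    and "r > 0" and "lam > 0"
    and "linear T"
    and "\<forall>i j. 0 \<le> k i j"
    and "\<forall>x\<in>orthant. \<forall>p i. x $ i = 0 \<longrightarrow> F x p $ i \<le> 0"
    and "T ` orthant \<subseteq> orthant"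
    and "\<exists>Rs>0. (\<forall>x\<in>orthant. (\<Sum>i\<in>UNIV. x $ i) \<ge> Rs \<longrightarrow> (\<forall>p. (\<Sum>i\<in>UNIV. F x p $ i) \<ge> 0))
               \<and> T ` B1 Rs \<subseteq> B1 Rs"
    and "\<forall>x\<in>orthant. \<forall>y\<in>orthant. \<forall>p q.
           (G x p - G y q) \<bullet> (x - y) + (F x p - F y q) \<bullet> (p - q) \<ge> 0"
    and "\<forall>i. \<not> (\<exists>(n::nat) (s :: nat \<Rightarrow> 'n). s 0 = i \<and> s (n + 1) = i \<and>
           (\<exists>l\<le>n + 1. s l \<noteq> i) \<and> (\<forall>l\<le>n. k (s l) (s (l + 1)) < \<infinity>))"
    and "\<forall>i j. k i j > 0"
  shows "(\<forall>U1 U2. impulse_monotone_solution F G r lam T k U1 \<longrightarrow>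
                   impulse_monotone_solution F G r lam T k U2 \<longrightarrow>
                   (\<forall>x\<in>orthant. U1 x = U2 x)) \<and>
         (\<forall>U. impulse_monotone_solution F G r lam T k U \<longrightarrow>
               (\<forall>x\<in>orthant. \<forall>y\<in>orthant. (U x - U y) \<bullet> (x - y) \<ge> 0))"
proof -
  obtain Rs where Rs: "Rs > 0" "T ` B1 Rs \<subseteq> B1 Rs"
    using assms(8) by blast
  have mono: "(G x p - G y q) \<bullet> (x - y) + (F x p - F y q) \<bullet> (p - q) \<ge> 0"
    if "x \<in> orthant" "y \<in> orthant" for x y p q
    using assms(9) that by blast
  note cross = impulse_solutions_cross_monotone[OF assms(2-4) Rs mono acyclic_jump_graph[OF assms(10)]]
  have "U1 x = U2 x" if "impulse_monotone_solution F G r lam T k U1"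
    "impulse_monotone_solution F G r lam T k U2" "x \<in> orthant" for U1 U2 x
  proof (rule cross_monotone_imp_eq[of U1 U2])
    show "continuous_on orthant U1" "continuous_on orthant U2"
      using that(1,2) by (auto simp: impulse_monotone_solution_def)
  qed (use that cross in blast)+
  then show ?thesis
    using cross by blast
qed

end
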